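(* Let $k$ and $d$ be positive integers, let $b_1,\dots,b_k\in\mathbb{N}$, and suppose that $$\mathcal{S}=\frac{\langle b_1,\dots,b_k\rangle}{d}.$$ Let $p>k$ be an integer and let $s_1,\dots,s_p\in\mathcal{S}$ be any elements (not necessarily distinct). Then there exists a nonempty subset $I\subseteq\{1,\dots,p\}$ such that $$\frac{1}{2}\sum_{i\in I}s_i\in\mathcal{S}$$ (in particular, $\sum_{i\in I}s_i$ is even).
   Context: Here $\mathbb{N}=\{0,1,2,\dots\}$. A numerical semigroup is a subset of $\mathbb{N}$ containing $0$ and closed under addition (finite complement in $\mathbb{N}$ is not required). $\langle b_1,\dots,b_k\rangle=\{b_1x_1+\cdots+b_kx_k: x_i\in\mathbb{N}\}$. For a numerical semigroup $\mathcal{T}$ and a positive integer $d$, the quotient is $\frac{\mathcal{T}}{d}=\{t\in\mathbb{N}: dt\in\mathcal{T}\}$, which is again a numerical semigroup. *)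

theory Defs
  imports Main
begin

text \<open>Finiteness of the complement is not required.\<close>

definition numerical_semigroup :: "nat set \<Rightarrow> bool" where
  "numerical_semigroup T \<longleftrightarrow> 0 \<in> T \<and> (\<forall>x\<in>T. \<forall>y\<in>T. x + y \<in> T)"

text \<open>The set of all combinations $b_1 x_1 + \cdots + b_k x_k$ with $x_i \in N$; only the values
  of \<open>b\<close> on \<open>{1..k}\<close> matter.\<close>

definition generated_semigroup :: "nat \<Rightarrow> (nat \<Rightarrow> nat) \<Rightarrow> nat set" where
  "generated_semigroup k b = {\<Sum>i = 1..k. b i * x i | x :: nat \<Rightarrow> nat. True}"

definition semigroup_quotient :: "nat set \<Rightarrow> nat \<Rightarrow> nat set" where
  "semigroup_quotient T d = {t. d * t \<in> T}"

lemma numerical_semigroup_generated: "numerical_semigroup (generated_semigroup k b)"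
proof -
  have "0 \<in> generated_semigroup k b"
    unfolding generated_semigroup_def by (auto intro!: exI[of _ "\<lambda>_. 0"])
  moreover have "u + v \<in> generated_semigroup k b"
    if uv: "u \<in> generated_semigroup k b" "v \<in> generated_semigroup k b" for u v
  proof -
    obtain x y where "u = (\<Sum>i = 1..k. b i * x i)" "v = (\<Sum>i = 1..k. b i * y i)"
      using uv unfolding generated_semigroup_def by blast
    then have "u + v = (\<Sum>i = 1..k. b i * (x i + y i))"
      by (simp add: distrib_left sum.distrib)
    then show ?thesis
      unfolding generated_semigroup_def by (auto intro!: exI[of _ "\<lambda>i. x i + y i"])
  qed
  ultimately show ?thesis
    unfolding numerical_semigroup_def by blast
qed

lemma numerical_semigroup_quotient:
  "numerical_semigroup T \<Longrightarrow> numerical_semigroup (semigroup_quotient T d)"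
  unfolding numerical_semigroup_def semigroup_quotient_def by (simp add: distrib_left)

end

theory Submission
  imports Defs
begin

text \<open>Write \<open>d s\<^sub>i = b \<cdot> x\<^sub>i\<close> with \<open>x\<^sub>i \<in> \<nat>\<^sup>k\<close>. As \<open>p > k\<close>, the \<open>x\<^sub>i\<close> satisfy a nontrivial integer relation
  \<open>\<Sum> c\<^sub>i x\<^sub>i = 0\<close>; dividing by the gcd, some \<open>c\<^sub>i\<close> is odd. Let \<open>I\<close> be the set of \<open>i\<close> with \<open>c\<^sub>i\<close> odd.
  Reducing the relation modulo 2 shows that \<open>\<Sum>\<^sub>I x\<^sub>i\<close> is even in every coordinate. Pairing it with
  \<open>b\<close> and cancelling \<open>d\<close> gives \<open>\<Sum> c\<^sub>i s\<^sub>i = 0\<close>, so \<open>\<Sum>\<^sub>I s\<^sub>i\<close> is even as well. Working over the integers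
  rather than modulo 2 is what makes this cancellation possible when \<open>d\<close> is even.\<close>

text \<open>Fraction-free Gaussian elimination by induction on the number of coordinates: each step
  uses up one vector as pivot and one coordinate, so vectors still outnumber coordinates.\<close>

lemma exists_integer_relation:
  fixes x :: "'a \<Rightarrow> nat \<Rightarrow> int"
  assumes "finite P" and "card P > k"
  shows "\<exists>c. (\<exists>i\<in>P. c i \<noteq> 0) \<and> (\<forall>j<k. (\<Sum>i\<in>P. c i * x i j) = 0)"
  using assms
proof (induction k arbitrary: P x)
  case 0
  then have "P \<noteq> {}" by auto
  then show ?case by (intro exI[of _ "\<lambda>_. 1"]) auto
next
  case (Suc k)
  show ?case
  proof (cases "\<forall>i\<in>P. x i k = 0")
    case True
    obtain c where "\<exists>i\<in>P. c i \<noteq> 0" "\<forall>j<k. (\<Sum>i\<in>P. c i * x i j) = 0"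
      using Suc.IH[of P x] Suc.prems by auto
    with True show ?thesis
      by (intro exI[of _ c]) (auto simp: less_Suc_eq)
  next
    case False
    then obtain m where m: "m \<in> P" "x m k \<noteq> 0" by blast
    define Q where "Q = P - {m}"
    \<comment> \<open>Cross-multiplying with the pivot \<open>x m k\<close> clears coordinate
      \<open>k\<close> without leaving the integers.\<close>
    define y where "y i j = x m k * x i j - x i k * x m j" for i j
    have Q: "finite Q" "card Q > k" "m \<notin> Q" "P = insert m Q"
      using Suc.prems m by (auto simp: Q_def)
    obtain c where c: "\<exists>i\<in>Q. c i \<noteq> 0" "\<forall>j<k. (\<Sum>i\<in>Q. c i * y i j) = 0"
      using Suc.IH[of Q y] Q by auto
    have "y i k = 0" for i
      by (simp add: y_def)
    with c(2) have c0: "(\<Sum>i\<in>Q. c i * y i j) = 0" if "j < Suc k" for j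
      using that by (auto simp: less_Suc_eq)
    \<comment> \<open>Expanding \<open>y\<close> in the relation for \<open>c\<close> and collecting
      the multiples of \<open>x m\<close> gives these coefficients. On \<open>Q\<close> the factor
      \<open>x m k\<close> is nonzero, so nontriviality survives.\<close>
    define c' where "c' i = (if i = m then - (\<Sum>i\<in>Q. c i * x i k) else c i * x m k)" for i
    have "(\<Sum>i\<in>P. c' i * x i j) = (\<Sum>i\<in>Q. c i * y i j)" for j
    proof -
      have "(\<Sum>i\<in>Q. c' i * x i j) = (\<Sum>i\<in>Q. c i * x m k * x i j)"
        using Q by (intro sum.cong) (auto simp: c'_def)
      then show ?thesis
        using Q by (simp add: c'_def y_def sum_distrib_left sum_distrib_right sum_subtractf algebra_simps)
    qed
    moreover have "\<exists>i\<in>P. c' i \<noteq> 0"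
      using c(1) m(2) Q(3,4) by (auto simp: c'_def)
    ultimately show ?thesis
      using c0 by (intro exI[of _ c']) auto
  qed
qed

lemma exists_integer_relation_odd:
  fixes x :: "'a \<Rightarrow> nat \<Rightarrow> int"
  assumes "finite P" and "card P > k"
  shows "\<exists>c. (\<exists>i\<in>P. odd (c i)) \<and> (\<forall>j<k. (\<Sum>i\<in>P. c i * x i j) = 0)"
proof -
  obtain c where c: "\<exists>i\<in>P. c i \<noteq> 0" "\<forall>j<k. (\<Sum>i\<in>P. c i * x i j) = 0"
    using exists_integer_relation[OF assms] by blast
  define g where "g = Gcd (c ` P)"
  have g: "g \<noteq> 0"
    using c(1) by (auto simp: g_def Gcd_0_iff)
  define c' where "c' i = c i div g" for i
  have c': "c i = g * c' i" if "i \<in> P" for i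
    using that by (simp add: c'_def g_def)
  have "\<exists>i\<in>P. odd (c' i)"
  proof (rule ccontr)
    assume "\<not> (\<exists>i\<in>P. odd (c' i))"
    \<comment> \<open>A common divisor \<open>g * 2\<close> of all coefficients would have to divide
      their gcd \<open>g\<close>.\<close>
    then have "g * 2 dvd c i" if "i \<in> P" for i
      using that by (simp add: c' mult_dvd_mono)
    then have "g * 2 dvd g"
      by (subst (2) g_def) (auto intro: Gcd_greatest)
    with g show False
      using dvd_mult_cancel_left[of g 2 1] by simp
  qed
  moreover have "(\<Sum>i\<in>P. c' i * x i j) = 0" if "j < k" for j
  proof -
    have "g * (\<Sum>i\<in>P. c' i * x i j) = (\<Sum>i\<in>P. c i * x i j)"
      by (simp add: sum_distrib_left c' mult.assoc)
    with c(2) that g show ?thesis by simp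
  qed
  ultimately show ?thesis by blast
qed

text \<open>Modulo 2, a term keeps \<open>f i\<close> if \<open>c i\<close> is odd and vanishes
  otherwise. This serves both for \<open>s\<close> and for each coordinate of
  \<open>x\<close>.\<close>

lemma even_sum_odd_coeffs:
  fixes c :: "'a \<Rightarrow> int" and f :: "'a \<Rightarrow> nat"
  assumes "finite P" and "(\<Sum>i\<in>P. c i * int (f i)) = 0"
  shows "even (\<Sum>i | i \<in> P \<and> odd (c i). f i)"
proof -
  have "even (\<Sum>i\<in>P. c i * int (f i) - (if odd (c i) then int (f i) else 0))"
    by (intro dvd_sum) auto
  then have "even (\<Sum>i\<in>P. if odd (c i) then int (f i) else 0)"
    using assms(2) by (simp add: sum_subtractf)
  then have "even (int (\<Sum>i | i \<in> P \<and> odd (c i). f i))"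
    using assms(1) by (simp add: sum.inter_filter if_distrib cong: if_cong)
  then show ?thesis by (simp only: even_of_nat)
qed

theorem theorem2p1:
  fixes k d p :: nat and b s :: "nat \<Rightarrow> nat" and S :: "nat set"
  assumes "k > 0" and "d > 0"
    and "S = semigroup_quotient (generated_semigroup k b) d"
    and "p > k"
    and "\<And>i. i \<in> {1..p} \<Longrightarrow> s i \<in> S"
  shows "\<exists>I. I \<noteq> {} \<and> I \<subseteq> {1..p} \<and> even (\<Sum>i\<in>I. s i) \<and> (\<Sum>i\<in>I. s i) div 2 \<in> S"
proof -
  have "\<forall>i\<in>{1..p}. \<exists>x. d * s i = (\<Sum>j = 1..k. b j * x j)"
    using assms(3,5) by (auto simp: semigroup_quotient_def generated_semigroup_def)
  then obtain x where x: "\<And>i. i \<in> {1..p} \<Longrightarrow> d * s i = (\<Sum>j = 1..k. b j * x i j)"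
    by metis
  obtain c where odd: "\<exists>i\<in>{1..p}. odd (c i)"
    and c: "\<forall>j<k. (\<Sum>i = 1..p. c i * int (x i (Suc j))) = 0"
    \<comment> \<open>The shift by \<open>Suc\<close> matches coordinates \<open>j < k\<close> with
      generators indexed from 1.\<close>
    using exists_integer_relation_odd[of "{1..p}" k "\<lambda>i j. int (x i (Suc j))"] assms(4) by auto
  have rel: "(\<Sum>i = 1..p. c i * int (x i j)) = 0" if "j \<in> {1..k}" for j
    using c that by (cases j) auto
  define I where "I = {i. i \<in> {1..p} \<and> odd (c i)}"
  have I: "I \<noteq> {}" "I \<subseteq> {1..p}"
    using odd by (auto simp: I_def)
  have "int d * (\<Sum>i = 1..p. c i * int (s i)) = (\<Sum>i = 1..p. c i * int (d * s i))"
    by (simp add: sum_distrib_left algebra_simps)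
  also have "\<dots> = (\<Sum>i = 1..p. \<Sum>j = 1..k. int (b j) * (c i * int (x i j)))"
    by (intro sum.cong refl) (simp add: x sum_distrib_left algebra_simps)
  also have "\<dots> = (\<Sum>j = 1..k. int (b j) * (\<Sum>i = 1..p. c i * int (x i j)))"
    unfolding sum_distrib_left by (rule sum.swap)
  also have "\<dots> = 0"
    by (intro sum.neutral ballI) (simp only: rel mult_zero_right)
  finally have "(\<Sum>i = 1..p. c i * int (s i)) = 0"
    using assms(2) by simp
  then have even_s: "even (\<Sum>i\<in>I. s i)"
    unfolding I_def by (intro even_sum_odd_coeffs) auto
  have even_x: "even (\<Sum>i\<in>I. x i j)" if "j \<in> {1..k}" for j
    unfolding I_def using rel[OF that] by (intro even_sum_odd_coeffs) auto
  \<comment> \<open>Both sides are kept doubled so that the exact halves of the coordinate sums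
    emerge as the witness for membership in \<open>S\<close>.\<close>
  have "2 * (d * ((\<Sum>i\<in>I. s i) div 2)) = (\<Sum>i\<in>I. d * s i)"
    using even_s by (simp add: sum_distrib_left mult.left_commute[of 2])
  also have "\<dots> = (\<Sum>i\<in>I. \<Sum>j = 1..k. b j * x i j)"
    using I(2) by (intro sum.cong refl x) auto
  also have "\<dots> = (\<Sum>j = 1..k. b j * (\<Sum>i\<in>I. x i j))"
    unfolding sum_distrib_left by (rule sum.swap)
  also have "\<dots> = (\<Sum>j = 1..k. 2 * (b j * ((\<Sum>i\<in>I. x i j) div 2)))"
    by (intro sum.cong refl) (simp add: even_x mult.left_commute[of 2])
  also have "\<dots> = 2 * (\<Sum>j = 1..k. b j * ((\<Sum>i\<in>I. x i j) div 2))"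
    by (rule sum_distrib_left[symmetric])
  finally have "d * ((\<Sum>i\<in>I. s i) div 2) = (\<Sum>j = 1..k. b j * ((\<Sum>i\<in>I. x i j) div 2))"
    by simp
  then have "(\<Sum>i\<in>I. s i) div 2 \<in> S"
    unfolding assms(3) semigroup_quotient_def generated_semigroup_def mem_Collect_eq
    by (intro exI[of _ "\<lambda>j. (\<Sum>i\<in>I. x i j) div 2"] conjI TrueI)
  with I even_s show ?thesis by blast
qed

end
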